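(* Let $p_1,p_2,p_3\in\{3,4,5,\dots\}\cup\{\infty\}$ and consider the $(p_1,p_2,p_3)$-triangle group with parameter $t\in(-t_\infty,t_\infty)$. The element $w_A=\iota_3\iota_2\iota_3\iota_1$ is regular elliptic if and only if $|t|>t_A$, where $$t_A=\sqrt{\frac{1+c_A}{1-c_A}}\quad\text{and}\quad c_A=\frac{4r_1^2r_2^2+r_3^2-1}{4r_1r_2r_3}.$$ (For $c_A\ge 1$ one sets $t_A=+\infty$, and for $c_A<-1$ one sets $t_A=-\infty$.)
   Context: $\mathbb C^{2,1}$ is $\mathbb C^3$ with the Hermitian form $\langle z,w\rangle=z_1\bar w_1+z_2\bar w_2-z_3\bar w_3$. The complex hyperbolic plane $H^2_{\mathbb C}$ is the projectivisation of the set of vectors with $\langle z,z\rangle<0$; its ideal boundary is the projectivisation of the set of nonzero null vectors; its holomorphic isometry group is $\mathrm{PU}(2,1)$. A complex geodesic $C$ is the projectivisation (intersected with $H^2_{\mathbb C}$) of the orthogonal complement of a vector $c$ with $\langle c,c\rangle>0$; $c$ is called a polar vector of $C$, normalised if $\langle c,c\rangle=1$. Two complex geodesics with normalised polar vectors $c,c'$ meet in $H^2_{\mathbb C}$ at angle $\varphi\in(0,\pi/2]$ iff $|\langle c,c'\rangle|=\cos\varphi<1$; distinct complex geodesics have closures meeting in one point of the ideal boundary ("angle $0$") iff $|\langle c,c'\rangle|=1$. A complex hyperbolic triangle is a triple $(C_1,C_2,C_3)$ of complex geodesics, with normalised polar vectors $c_k$ (indices mod 3) and $r_k=|\langle c_{k-1},c_{k+1}\rangle|$.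 It is a $(p_1,p_2,p_3)$-triangle if $C_{k-1}$ and $C_{k+1}$ meet at angle $\pi/p_k$ for each $k$ (with $\pi/\infty=0$), so $r_k=\cos(\pi/p_k)$. Its angular invariant is $\alpha=\arg\left(\prod_{k=1}^3\langle c_{k-1},c_{k+1}\rangle\right)$. The complex reflection in $C_k$ is $\iota_k(z)=-z+2\langle z,c_k\rangle c_k$, an element of $\mathrm{SU}(2,1)$, and the $(p_1,p_2,p_3)$-triangle group is generated by $\iota_1,\iota_2,\iota_3$. These groups are parameterised by $t=\cot(\alpha/2)$, so $|t|=\sqrt{(1+\cos\alpha)/(1-\cos\alpha)}$; such a (nondegenerate) group exists for $t\in(-t_\infty,t_\infty)$, where $t_\infty=\sqrt{(1+c_\infty)/(1-c_\infty)}$ and $c_\infty=\frac{r_1^2+r_2^2+r_3^2-1}{2r_1r_2r_3}$ (with $t_\infty=+\infty$ if $c_\infty\ge1$ and $t_\infty=-\infty$ if $c_\infty<-1$). An isometry in $\mathrm{PU}(2,1)$ is elliptic if it has a fixed point in $H^2_{\mathbb C}$, and regular elliptic if in addition all eigenvalues of a representing matrix are distinct. *)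

theory Defs
  imports "HOL-Analysis.Analysis"
begin

text \<open>
  The Hermitian form of signature (2,1). Since \<^term>\<open>herm z z\<close> is always real,
  its sign is expressed through its real part below.
\<close>

definition herm :: "complex^3 \<Rightarrow> complex^3 \<Rightarrow> complex"
  where "herm z w = z$1 * cnj (w$1) + z$2 * cnj (w$2) - z$3 * cnj (w$3)"

text \<open>Points of the complex projective plane are represented as complex lines \<^term>\<open>vec.span {z}\<close>.\<close>

definition H2C :: "(complex^3) set set"
  where "H2C = {vec.span {z} |z. Re (herm z z) < 0}"

definition ideal_boundary :: "(complex^3) set set"
  where "ideal_boundary = {vec.span {z} |z. z \<noteq> 0 \<and> herm z z = 0}"

text \<open>
  The complex geodesic with polar vector \<open>c\<close> (where \<^term>\<open>Re (herm c c) > 0\<close>), and its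
  closure in \<^term>\<open>H2C \<union> ideal_boundary\<close>.
\<close>

definition complex_geodesic :: "complex^3 \<Rightarrow> (complex^3) set set"
  where "complex_geodesic c = {vec.span {z} |z. Re (herm z z) < 0 \<and> herm z c = 0}"

definition geodesic_closure :: "complex^3 \<Rightarrow> (complex^3) set set"
  where "geodesic_closure c = {vec.span {z} |z. z \<noteq> 0 \<and> Re (herm z z) \<le> 0 \<and> herm z c = 0}"

text \<open>
  The complex geodesics with normalised polar vectors \<open>c\<close> and \<open>c'\<close> meet at angle \<open>\<phi>\<close>.
  Angle 0 means that they are distinct and their closures meet in a single point, which is ideal.
\<close>

definition meet_at_angle :: "complex^3 \<Rightarrow> complex^3 \<Rightarrow> real \<Rightarrow> bool"
  where "meet_at_angle c c' \<phi> \<longleftrightarrow>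
    (if \<phi> = 0
     then complex_geodesic c \<noteq> complex_geodesic c' \<and>
          (\<exists>x\<in>ideal_boundary. geodesic_closure c \<inter> geodesic_closure c' = {x})
     else 0 < \<phi> \<and> \<phi> \<le> pi / 2 \<and> complex_geodesic c \<inter> complex_geodesic c' \<noteq> {} \<and>
          cmod (herm c c') = cos \<phi>)"

definition pi_over :: "enat \<Rightarrow> real"
  where "pi_over p = (case p of enat n \<Rightarrow> pi / real n | \<infinity> \<Rightarrow> 0)"

text \<open>
  Triangles are given by normalised polar vectors \<open>c 1\<close>, \<open>c 2\<close>, \<open>c 3\<close> of their sides. The index
  type \<^typ>\<open>3\<close> is the integers modulo 3, so \<open>c (k - 1)\<close> and \<open>c (k + 1)\<close> are taken
  cyclically (and \<open>3 = 0\<close> there).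
\<close>

definition is_triangle :: "(3 \<Rightarrow> enat) \<Rightarrow> (3 \<Rightarrow> complex^3) \<Rightarrow> bool"
  where "is_triangle p c \<longleftrightarrow>
    (\<forall>k. herm (c k) (c k) = 1) \<and>
    (\<forall>k. meet_at_angle (c (k - 1)) (c (k + 1)) (pi_over (p k)))"

definition side_r :: "(3 \<Rightarrow> complex^3) \<Rightarrow> 3 \<Rightarrow> real"
  where "side_r c k = cmod (herm (c (k - 1)) (c (k + 1)))"

definition angular_invariant :: "(3 \<Rightarrow> complex^3) \<Rightarrow> real"
  where "angular_invariant c = Arg (\<Prod>k\<in>UNIV. herm (c (k - 1)) (c (k + 1)))"

text \<open>
  The parameter is cot(alpha/2) for the angular invariant alpha. It is not defined for alpha = 0,
  which has to be excluded explicitly as \<^term>\<open>cot 0 = (0::real)\<close> in HOL.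
\<close>

definition has_parameter :: "(3 \<Rightarrow> complex^3) \<Rightarrow> real \<Rightarrow> bool"
  where "has_parameter c t \<longleftrightarrow> angular_invariant c \<noteq> 0 \<and> t = cot (angular_invariant c / 2)"

definition parameter_bound :: "real \<Rightarrow> ereal"
  where "parameter_bound x =
    (if x \<ge> 1 then \<infinity> else if x < -1 then -\<infinity> else ereal (sqrt ((1 + x) / (1 - x))))"

definition c_inf :: "(3 \<Rightarrow> real) \<Rightarrow> real"
  where "c_inf r = ((r 1)\<^sup>2 + (r 2)\<^sup>2 + (r 3)\<^sup>2 - 1) / (2 * r 1 * r 2 * r 3)"

definition c_A :: "(3 \<Rightarrow> real) \<Rightarrow> real"
  where "c_A r = (4 * (r 1)\<^sup>2 * (r 2)\<^sup>2 + (r 3)\<^sup>2 - 1) / (4 * r 1 * r 2 * r 3)"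

definition t_inf :: "(3 \<Rightarrow> real) \<Rightarrow> ereal"
  where "t_inf r = parameter_bound (c_inf r)"

definition t_A :: "(3 \<Rightarrow> real) \<Rightarrow> ereal"
  where "t_A r = parameter_bound (c_A r)"

definition U21 :: "(complex^3^3) set"
  where "U21 = {A. \<forall>z w. herm (A *v z) (A *v w) = herm z w}"

definition complex_reflection :: "complex^3 \<Rightarrow> complex^3^3"
  where "complex_reflection c = matrix (\<lambda>z. - z + (2 * herm z c) *s c)"

text \<open>
  An element of PU(2,1) is given by a representing matrix in \<^term>\<open>U21\<close>; the notions below do
  not depend on its choice. The eigenvalues of a 3-by-3 matrix are pairwise distinct iff the set
  of eigenvalues has three elements.
\<close>

definition elliptic :: "complex^3^3 \<Rightarrow> bool"
  where "elliptic A \<longleftrightarrow> A \<in> U21 \<and> (\<exists>x\<in>H2C. (*v) A ` x = x)"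

definition eigenvalues :: "complex^3^3 \<Rightarrow> complex set"
  where "eigenvalues A = {\<mu>. \<exists>v. v \<noteq> 0 \<and> A *v v = \<mu> *s v}"

definition regular_elliptic :: "complex^3^3 \<Rightarrow> bool"
  where "regular_elliptic A \<longleftrightarrow> elliptic A \<and> card (eigenvalues A) = 3"

definition word_A :: "(3 \<Rightarrow> complex^3) \<Rightarrow> complex^3^3"
  where "word_A c = complex_reflection (c 3) ** complex_reflection (c 2) **
                    complex_reflection (c 3) ** complex_reflection (c 1)"

lemma complex_reflection_apply:
  "complex_reflection c *v z = - z + (2 * herm z c) *s c"
proof -
  have "Vector_Spaces.linear (*s) (*s) (\<lambda>z. - z + (2 * herm z c) *s c)"
    by unfold_locales (simp_all add: herm_def vec_eq_iff algebra_simps)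
  then show ?thesis
    by (simp add: complex_reflection_def matrix_works)
qed

lemma complex_reflection_in_U21:
  assumes "herm c c = 1"
  shows "complex_reflection c \<in> U21"
proof -
  have "herm (- z + (2 * herm z c) *s c) (- w + (2 * herm w c) *s c)
      = herm z w - 2 * cnj (herm w c) * herm z c - 2 * herm z c * herm c w
        + 4 * herm z c * cnj (herm w c) * herm c c" for z w
    unfolding herm_def by (simp add: algebra_simps)
  moreover have "cnj (herm w c) = herm c w" for w
    by (simp add: herm_def)
  ultimately show ?thesis
    using assms by (simp add: U21_def complex_reflection_apply)
qed

lemma det_complex_reflection:
  assumes "herm c c = 1"
  shows "det (complex_reflection c) = 1"
proof -
  have "det (complex_reflection c) = 2 * herm c c - 1"
    unfolding det_3 complex_reflection_def matrix_def herm_def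
    by (simp add: axis_def algebra_simps)
  with assms show ?thesis by simp
qed

end

theory Submission
  imports Defs
begin

text \<open>
  Conjugating by \<open>\<iota>\<^sub>3\<close> shows that \<open>w\<^sub>A\<close> is the product of the complex reflections with polar
  vectors \<open>c\<^sub>1\<close> and \<open>\<iota>\<^sub>3 c\<^sub>2\<close>. A product of the reflections in \<open>a\<close> and \<open>b\<close> is the identity on the
  orthogonal complement of \<open>a, b\<close>, and on their span it has determinant 1 and trace \<open>4s - 2\<close>, where
  \<open>s = |\<langle>a, b\<rangle>|\<^sup>2\<close>. The complement is spanned by a vector of norm \<open>s - 1\<close>, so for
  \<open>s \<noteq> 0\<close> the product is regular elliptic iff \<open>s < 1\<close>. For \<open>a = c\<^sub>1\<close>, \<open>b = \<iota>\<^sub>3 c\<^sub>2\<close> one has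
  \<open>s = r\<^sub>3\<^sup>2 + 4 r\<^sub>1\<^sup>2 r\<^sub>2\<^sup>2 - 4 r\<^sub>1 r\<^sub>2 r\<^sub>3 cos \<alpha>\<close>, which is nonzero for \<open>\<alpha> \<noteq> 0\<close>, and \<open>s < 1\<close> means
  \<open>c\<^sub>A < cos \<alpha>\<close>.
\<close>

section \<open>The Hermitian form and its cross product\<close>

lemma herm_add_left: "herm (x + y) z = herm x z + herm y z"
  and herm_diff_left: "herm (x - y) z = herm x z - herm y z"
  and herm_minus_left: "herm (- x) z = - herm x z"
  and herm_scale_left: "herm (k *s x) z = k * herm x z"
  and herm_zero_left: "herm 0 z = 0"
  by (simp_all add: herm_def algebra_simps)

lemma herm_scale_right: "herm x (k *s z) = cnj k * herm x z"
  by (simp add: herm_def algebra_simps)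

lemma cnj_herm: "cnj (herm x y) = herm y x"
  by (simp add: herm_def)

lemmas herm_left = herm_add_left herm_diff_left herm_minus_left herm_scale_left herm_zero_left

lemma herm_mult_swap: "herm x y * herm y x = of_real ((cmod (herm x y))\<^sup>2)"
  by (metis cnj_herm complex_norm_square)

text \<open>The Euclidean cross product adapted to \<open>herm\<close>: conjugation and the sign of
  the last entry make \<open>herm (herm_cross a b) z\<close> the conjugate of the determinant of
  \<open>a\<close>, \<open>b\<close>, \<open>z\<close>.\<close>

definition herm_cross :: "complex^3 \<Rightarrow> complex^3 \<Rightarrow> complex^3"
  where "herm_cross a b = vector
    [cnj (a$2 * b$3 - a$3 * b$2), cnj (a$3 * b$1 - a$1 * b$3), - cnj (a$1 * b$2 - a$2 * b$1)]"

lemma herm_cross_left: "herm (herm_cross a b) a = 0"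
  and herm_cross_right: "herm (herm_cross a b) b = 0"
  by (simp_all add: herm_def herm_cross_def algebra_simps)

text \<open>Lagrange's identity in signature (2,1): the right side is minus the Gram determinant, so
  for unit vectors its sign is that of \<open>cmod (herm a b) - 1\<close>.\<close>

lemma herm_cross_self:
  "herm (herm_cross a b) (herm_cross a b) = herm a b * herm b a - herm a a * herm b b"
  by (simp add: herm_def herm_cross_def algebra_simps)

text \<open>Projection to the line of the cross product, cleared of denominators so that it follows
  by polynomial algebra and also covers null cross products.\<close>

lemma orthogonal_eq_multiple_herm_cross:
  assumes "herm z a = 0" and "herm z b = 0"
  shows "herm (herm_cross a b) (herm_cross a b) *s z = herm z (herm_cross a b) *s herm_cross a b"
proof -
  \<comment> \<open>For \<open>algebra\<close>, entries and their conjugates are independent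
    unknowns, so the conjugated equations are supplied too.\<close>
  have "herm a z = 0" "herm b z = 0"
    using assms by (metis cnj_herm complex_cnj_zero)+
  then show ?thesis
    using assms unfolding vec_eq_iff forall_3 herm_def herm_cross_def
    by simp (intro conjI; algebra)
qed

text \<open>The cross product is not null here, so the projection formula can be divided by its
  norm. The sign of \<open>herm z z\<close> later rules out negative or null vectors in the
  complement.\<close>

lemma herm_orthogonal_self:
  assumes "herm z a = 0" and "herm z b = 0" and "herm a a = 1" and "herm b b = 1"
    and "cmod (herm a b) \<noteq> 1"
  obtains k where "z = k *s herm_cross a b"
    and "Re (herm z z) = (cmod k)\<^sup>2 * ((cmod (herm a b))\<^sup>2 - 1)"
proof -
  let ?n = "herm_cross a b"
  have n: "herm ?n ?n = of_real ((cmod (herm a b))\<^sup>2 - 1)"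
    using assms by (simp add: herm_cross_self herm_mult_swap)
  have "(cmod (herm a b))\<^sup>2 \<noteq> 1"
    using assms(5) by (simp add: power2_eq_1_iff)
      (metis norm_ge_zero not_one_le_zero neg_0_le_iff_le)
  then have nz: "herm ?n ?n \<noteq> 0"
    unfolding n of_real_eq_0_iff by simp
  define k where "k = herm z ?n / herm ?n ?n"
  have "z = inverse (herm ?n ?n) *s (herm ?n ?n *s z)"
    using nz by simp
  also have "\<dots> = k *s ?n"
    unfolding orthogonal_eq_multiple_herm_cross[OF assms(1,2)]
    by (simp add: k_def divide_inverse mult.commute)
  finally have z: "z = k *s ?n" .
  have "herm (k *s ?n) (k *s ?n) = of_real ((cmod k)\<^sup>2) * herm ?n ?n"
    by (simp only: herm_scale_left herm_scale_right complex_norm_square mult.assoc mult.left_commute)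
  also have "\<dots> = of_real ((cmod k)\<^sup>2 * ((cmod (herm a b))\<^sup>2 - 1))"
    by (simp add: n)
  finally have "Re (herm z z) = (cmod k)\<^sup>2 * ((cmod (herm a b))\<^sup>2 - 1)"
    unfolding z[symmetric] by simp
  with z that show thesis by blast
qed

section \<open>Products of two complex reflections\<close>

lemma reflection_product_apply:
  "(complex_reflection b ** complex_reflection a) *v z =
    z - (2 * herm z a) *s a - (2 * herm z b - 4 * herm z a * herm a b) *s b"
  by (simp add: matrix_vector_mul_assoc[symmetric] complex_reflection_apply herm_left
      vec_eq_iff algebra_simps)

lemma reflection_product_in_U21:
  assumes "herm a a = 1" and "herm b b = 1"
  shows "complex_reflection b ** complex_reflection a \<in> U21"
  using complex_reflection_in_U21[OF assms(1)] complex_reflection_in_U21[OF assms(2)]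
  by (simp add: U21_def matrix_vector_mul_assoc[symmetric])

text \<open>Pairing the eigenvector equation with \<open>a\<close> and \<open>b\<close> gives a
  2-by-2 eigenvalue problem for \<open>herm v a\<close> and \<open>herm v b\<close>; the quadratic
  is its characteristic equation.\<close>

lemma reflection_product_eigenvector:
  assumes "herm a a = 1" and "herm b b = 1"
    and eig: "(complex_reflection b ** complex_reflection a) *v v = \<mu> *s v"
  shows "herm v a = 0 \<and> herm v b = 0 \<or>
    \<mu>\<^sup>2 + 1 = (4 * of_real ((cmod (herm a b))\<^sup>2) - 2) * \<mu>"
proof -
  let ?x = "herm v a" and ?y = "herm v b" and ?g = "herm a b" and ?h = "herm b a"
  note e = eig[unfolded reflection_product_apply, symmetric]
  have x: "\<mu> * ?x = (4 * (?g * ?h) - 1) * ?x - 2 * ?h * ?y"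
    using arg_cong[OF e, of "\<lambda>u. herm u a"] assms(1)
    by (simp add: herm_left algebra_simps)
  have y: "\<mu> * ?y = 2 * ?g * ?x - ?y"
    using arg_cong[OF e, of "\<lambda>u. herm u b"] assms(2)
    by (simp add: herm_left algebra_simps)
  have "(\<mu>\<^sup>2 + 1 - (4 * (?g * ?h) - 2) * \<mu>) * ?x = 0"
    using x y by algebra
  moreover have "(\<mu>\<^sup>2 + 1 - (4 * (?g * ?h) - 2) * \<mu>) * ?y = 0"
    using x y by algebra
  ultimately have "?x = 0 \<and> ?y = 0 \<or> \<mu>\<^sup>2 + 1 = (4 * (?g * ?h) - 2) * \<mu>"
    by auto
  then show ?thesis
    by (simp only: herm_mult_swap)
qed

lemma eigenvalues_reflection_product_subset:
  assumes "herm a a = 1" and "herm b b = 1"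
  shows "eigenvalues (complex_reflection b ** complex_reflection a)
    \<subseteq> insert 1 {\<mu>. \<mu>\<^sup>2 + 1 = (4 * of_real ((cmod (herm a b))\<^sup>2) - 2) * \<mu>}"
proof
  fix \<mu> assume "\<mu> \<in> eigenvalues (complex_reflection b ** complex_reflection a)"
  then obtain v where v: "v \<noteq> 0" "(complex_reflection b ** complex_reflection a) *v v = \<mu> *s v"
    by (auto simp: eigenvalues_def)
  have "\<mu> = 1" if "herm v a = 0" "herm v b = 0"
  proof -
    from v(2) that have "v = \<mu> *s v"
      by (simp add: reflection_product_apply)
    then show ?thesis
      using v(1) by (metis vec.scale_cancel_right vector_smult_lid)
  qed
  then show "\<mu> \<in> insert 1 {\<mu>. \<mu>\<^sup>2 + 1 = (4 * of_real ((cmod (herm a b))\<^sup>2) - 2) * \<mu>}"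
    using reflection_product_eigenvector[OF assms v(2)] by blast
qed

lemma eigenvalues_reflection_product:
  assumes "herm a a = 1" and "herm b b = 1" and "cmod (herm a b) \<noteq> 1" and "herm a b \<noteq> 0"
  shows "eigenvalues (complex_reflection b ** complex_reflection a)
    = insert 1 {\<mu>. \<mu>\<^sup>2 + 1 = (4 * of_real ((cmod (herm a b))\<^sup>2) - 2) * \<mu>}"
proof (rule antisym[OF eigenvalues_reflection_product_subset[OF assms(1,2)]], rule subsetI)
  let ?A = "complex_reflection b ** complex_reflection a"
  let ?g = "herm a b" and ?h = "herm b a"
  have s1: "?g * ?h \<noteq> 1"
    using assms(3) unfolding herm_mult_swap of_real_eq_1_iff
    by (metis abs_norm_cancel abs_1 real_sqrt_abs real_sqrt_one)
  have hz: "?h \<noteq> 0" using assms(4) cnj_herm by (metis complex_cnj_zero_iff)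
  fix \<mu> :: complex
  assume "\<mu> \<in> insert 1 {\<mu>. \<mu>\<^sup>2 + 1 = (4 * of_real ((cmod ?g)\<^sup>2) - 2) * \<mu>}"
  then consider "\<mu> = 1" | "\<mu>\<^sup>2 + 1 = (4 * (?g * ?h) - 2) * \<mu>"
    by (auto simp: herm_mult_swap)
  then show "\<mu> \<in> eigenvalues ?A"
  proof cases
    case 1
    let ?n = "herm_cross a b"
    have "herm ?n ?n \<noteq> 0"
      using s1 assms(1,2) by (simp add: herm_cross_self)
    then have "?n \<noteq> 0" by (metis herm_zero_left)
    moreover have "?A *v ?n = \<mu> *s ?n"
      by (simp add: reflection_product_apply herm_cross_left herm_cross_right 1)
    ultimately show ?thesis by (auto simp: eigenvalues_def)
  next
    case 2
    \<comment> \<open>These coefficients solve the \<open>a\<close>-component of the eigenvector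
      equation; the \<open>b\<close>-component is then the quadratic for
      \<open>\<mu>\<close>.\<close>
    let ?v = "(2 * ?h) *s a - (\<mu> + 1) *s b"
    have "\<mu> \<noteq> 1" using 2 s1 by auto
    \<comment> \<open>Pairing with \<open>a\<close> shows \<open>?v\<close> to be nonzero without an
      appeal to the independence of \<open>a\<close> and \<open>b\<close>.\<close>
    moreover have "herm ?v a = (1 - \<mu>) * ?h"
      using assms(1) by (simp add: herm_left algebra_simps)
    ultimately have "?v \<noteq> 0"
      using hz by (metis herm_zero_left mult_eq_0_iff eq_iff_diff_eq_0)
    moreover have "?A *v ?v = \<mu> *s ?v"
    proof -
      have va: "herm ?v a = 2 * ?h - (\<mu> + 1) * ?h" and vb: "herm ?v b = 2 * ?h * ?g - (\<mu> + 1)"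
        using assms(1,2) by (simp_all add: herm_left algebra_simps)
      have "2 * ?h - 2 * herm ?v a = \<mu> * (2 * ?h)"
        unfolding va by (simp add: algebra_simps)
      moreover have "- (\<mu> + 1) - (2 * herm ?v b - 4 * herm ?v a * ?g) = - (\<mu> * (\<mu> + 1))"
        unfolding va vb using 2 by algebra
      moreover have "?A *v ?v = (2 * ?h - 2 * herm ?v a) *s a
          + (- (\<mu> + 1) - (2 * herm ?v b - 4 * herm ?v a * ?g)) *s b"
        unfolding reflection_product_apply vec_eq_iff by (simp add: algebra_simps)
      ultimately have "?A *v ?v = (\<mu> * (2 * ?h)) *s a + (- (\<mu> * (\<mu> + 1))) *s b"
        by (simp only:)
      also have "\<dots> = \<mu> *s ?v"
        by (simp add: vec_eq_iff algebra_simps)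
      finally show ?thesis .
    qed
    ultimately show ?thesis unfolding eigenvalues_def by blast
  qed
qed

lemma card_eigenvalues_reflection_product:
  assumes "herm a a = 1" and "herm b b = 1" and "cmod (herm a b) \<noteq> 1" and "herm a b \<noteq> 0"
  shows "card (eigenvalues (complex_reflection b ** complex_reflection a)) = 3"
proof -
  define s :: complex where "s = of_real ((cmod (herm a b))\<^sup>2)"
  \<comment> \<open>The discriminant of the quadratic is \<open>16 * w\<^sup>2\<close>. It is
    negative for \<open>s\<close> between 0 and 1, hence the complex root.\<close>
  define w where "w = csqrt (s\<^sup>2 - s)"
  have w2: "w\<^sup>2 = s\<^sup>2 - s" by (simp add: w_def)
  have s: "s \<noteq> 0" "s \<noteq> 1"
  proof -
    show "s \<noteq> 0" using assms(4) by (simp add: s_def)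
    show "s \<noteq> 1" using assms(3) unfolding s_def of_real_eq_1_iff
      by (metis abs_norm_cancel abs_1 real_sqrt_abs real_sqrt_one)
  qed
  then have w0: "w \<noteq> 0" using w2 by (auto simp: power2_eq_square)
  have "\<mu>\<^sup>2 + 1 = (4 * s - 2) * \<mu> \<longleftrightarrow> \<mu> = 2 * s - 1 + 2 * w \<or> \<mu> = 2 * s - 1 - 2 * w" for \<mu>
  proof -
    have "\<mu>\<^sup>2 + 1 - (4 * s - 2) * \<mu> = (\<mu> - (2 * s - 1 + 2 * w)) * (\<mu> - (2 * s - 1 - 2 * w))"
      using w2 by algebra
    then show ?thesis by (metis eq_iff_diff_eq_0 mult_eq_0_iff)
  qed
  then have "eigenvalues (complex_reflection b ** complex_reflection a)
      = {1, 2 * s - 1 + 2 * w, 2 * s - 1 - 2 * w}"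
    unfolding eigenvalues_reflection_product[OF assms] s_def[symmetric] by auto
  moreover have "1 \<noteq> 2 * s - 1 + 2 * w" "1 \<noteq> 2 * s - 1 - 2 * w"
    using w2 s(2) by algebra+
  moreover have "2 * s - 1 + 2 * w \<noteq> 2 * s - 1 - 2 * w"
    using w0 by algebra
  ultimately show ?thesis by simp
qed

text \<open>Below 1 the cross product is a negative fixed vector; at 1 the only possible eigenvalue
  is 1; above 1 no eigenvector is negative. For orthogonal \<open>a\<close> and \<open>b\<close> the
  eigenvalue -1 would be double, whence \<open>ab\<close>.\<close>

lemma regular_elliptic_reflection_product_iff:
  assumes a: "herm a a = 1" and b: "herm b b = 1" and ab: "herm a b \<noteq> 0"
  shows "regular_elliptic (complex_reflection b ** complex_reflection a) \<longleftrightarrow> cmod (herm a b) < 1"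
proof
  let ?A = "complex_reflection b ** complex_reflection a" and ?n = "herm_cross a b"
  assume s: "cmod (herm a b) < 1"
  then have "(cmod (herm a b))\<^sup>2 < 1"
    by (simp add: power_less_one_iff)
  then have "Re (herm ?n ?n) < 0"
    by (simp add: herm_cross_self herm_mult_swap a b)
  then have "vec.span {?n} \<in> H2C"
    by (auto simp: H2C_def)
  moreover have "?A *v z = z" if "z \<in> vec.span {?n}" for z
    using that by (auto simp: vec.span_singleton reflection_product_apply herm_left
        herm_cross_left herm_cross_right)
  then have "(*v) ?A ` vec.span {?n} = vec.span {?n}"
    by simp
  ultimately show "regular_elliptic ?A"
    using card_eigenvalues_reflection_product[OF a b _ ab] s reflection_product_in_U21[OF a b]
    by (auto simp: regular_elliptic_def elliptic_def)
next
  let ?A = "complex_reflection b ** complex_reflection a" and ?s = "(cmod (herm a b))\<^sup>2"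
  assume reg: "regular_elliptic ?A"
  show "cmod (herm a b) < 1"
  proof (rule ccontr)
    assume "\<not> cmod (herm a b) < 1"
    then consider "cmod (herm a b) = 1" | "cmod (herm a b) > 1" by linarith
    then show False
    proof cases
      case 1
      have "\<mu> = 1" if "\<mu>\<^sup>2 + 1 = 2 * \<mu>" for \<mu> :: complex
        using that by algebra
      then have "eigenvalues ?A \<subseteq> {1}"
        using eigenvalues_reflection_product_subset[OF a b] 1 by auto
      then have "card (eigenvalues ?A) \<le> card {1 :: complex}"
        by (intro card_mono) auto
      with reg show False by (simp add: regular_elliptic_def)
    next
      case 2
      then have s: "?s > 1" by (simp add: one_less_power)
      from reg obtain z where z: "Re (herm z z) < 0"
        and im: "(*v) ?A ` vec.span {z} = vec.span {z}"
        by (auto simp: regular_elliptic_def elliptic_def H2C_def)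
      have "?A *v z \<in> vec.span {z}"
        using im vec.span_base[of z "{z}"] by blast
      then obtain \<mu> where eig: "?A *v z = \<mu> *s z"
        by (auto simp: vec.span_singleton)
      have "herm z z = herm (\<mu> *s z) (\<mu> *s z)"
        using reflection_product_in_U21[OF a b] eig by (simp add: U21_def) metis
      then have "herm z z = (\<mu> * cnj \<mu>) * herm z z"
        by (simp only: herm_scale_left herm_scale_right mult.assoc mult.left_commute)
      moreover have "herm z z \<noteq> 0" using z by auto
      ultimately have unit: "\<mu> * cnj \<mu> = 1"
        by simp
      from reflection_product_eigenvector[OF a b eig] show False
      proof
        assume "herm z a = 0 \<and> herm z b = 0"
        then obtain k where "Re (herm z z) = (cmod k)\<^sup>2 * (?s - 1)"
          using herm_orthogonal_self[of z a b] a b 2 by (metis less_irrefl)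
        moreover have "0 \<le> (cmod k)\<^sup>2 * (?s - 1)" using s by simp
        ultimately show False using z by linarith
      next
        assume "\<mu>\<^sup>2 + 1 = (4 * of_real ?s - 2) * \<mu>"
        \<comment> \<open>The inverse of \<open>\<mu>\<close> is its conjugate, so dividing by
          \<open>\<mu>\<close> leaves twice its real part, which would have to exceed 2.\<close>
        then have "\<mu> + cnj \<mu> = 4 * of_real ?s - 2"
          using unit by algebra
        then have "2 * Re \<mu> = 4 * ?s - 2"
          by (simp add: complex_eq_iff)
        moreover have "cmod \<mu> = 1"
          using unit by (metis complex_mod_sqrt_Re_mult_cnj one_complex.sel(1) real_sqrt_one)
        then have "Re \<mu> \<le> 1"
          using complex_Re_le_cmod[of \<mu>] by simp
        ultimately show False using s by linarith
      qed
    qed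
  qed
qed

section \<open>Reduction of the triangle group element to two reflections\<close>

text \<open>A reflection in a unit vector is an involutive isometry, hence self-adjoint, so
  conjugation by it just moves the polar vector.\<close>

lemma complex_reflection_conjugate:
  assumes "herm c c = 1"
  shows "complex_reflection c ** complex_reflection d ** complex_reflection c
    = complex_reflection (complex_reflection c *v d)"
proof -
  let ?R = "complex_reflection c"
  have inv: "?R *v (?R *v z) = z" for z
    using assms by (simp add: complex_reflection_apply herm_left vec_eq_iff algebra_simps)
  have "herm (?R *v z) d = herm z (?R *v d)" for z
  proof -
    have "herm (?R *v z) (?R *v (?R *v d)) = herm z (?R *v d)"
      using complex_reflection_in_U21[OF assms] by (simp add: U21_def)
    then show ?thesis by (simp only: inv)
  qed
  moreover have "?R *v (- (?R *v z) + k *s d) = - z + k *s (?R *v d)" for z k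
  proof -
    have "?R *v (- u + k *s d) = - (?R *v u) + k *s (?R *v d)" for u
      by (simp add: complex_reflection_apply herm_left vec_eq_iff algebra_simps)
    then show ?thesis by (simp only: inv)
  qed
  ultimately show ?thesis
    unfolding matrix_eq matrix_vector_mul_assoc[symmetric] complex_reflection_apply[of d]
      complex_reflection_apply[of "?R *v d"] by simp
qed

text \<open>At angle 0 the common ideal point gives a null vector orthogonal to both polar vectors,
  whereas the complement of two orthogonal unit vectors is a negative line. At other angles below a
  right angle the cosine is positive.\<close>

lemma herm_nonzero_if_meet_at_angle:
  assumes "herm c c = 1" and "herm d d = 1" and "meet_at_angle c d \<phi>" and "\<phi> \<noteq> pi / 2"
  shows "herm c d \<noteq> 0"
proof (cases "\<phi> = 0")
  case True
  then obtain x where ideal: "x \<in> ideal_boundary"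
    and "geodesic_closure c \<inter> geodesic_closure d = {x}"
    using assms(3) by (auto simp: meet_at_angle_def)
  then have "x \<in> geodesic_closure c" "x \<in> geodesic_closure d" by blast+
  then obtain y z where x: "x = vec.span {y}" "x = vec.span {z}" "herm y c = 0" "herm z d = 0"
    unfolding geodesic_closure_def by blast
  obtain w where w: "x = vec.span {w}" "w \<noteq> 0" "herm w w = 0"
    using ideal by (auto simp: ideal_boundary_def)
  have "w \<in> vec.span {y}"
    using x w(1) vec.span_base[of w "{w}"] by auto
  then have orth_c: "herm w c = 0"
    using x(3) by (auto simp: vec.span_singleton herm_left)
  have "w \<in> vec.span {z}"
    using x w(1) vec.span_base[of w "{w}"] by auto
  then have orth_d: "herm w d = 0"
    using x(4) by (auto simp: vec.span_singleton herm_left)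
  show ?thesis
  proof
    assume 0: "herm c d = 0"
    obtain k where "w = k *s herm_cross c d"
      and "Re (herm w w) = (cmod k)\<^sup>2 * ((cmod (herm c d))\<^sup>2 - 1)"
      using herm_orthogonal_self[OF orth_c orth_d assms(1,2)] 0 by auto
    with w 0 show False by simp
  qed
next
  case False
  then have "0 < \<phi>" "\<phi> < pi / 2" "cmod (herm c d) = cos \<phi>"
    using assms(3,4) by (auto simp: meet_at_angle_def)
  then show ?thesis
    using cos_gt_zero_pi[of \<phi>] by auto
qed

lemma pi_over_neq_pi_half:
  assumes "3 \<le> p"
  shows "pi_over p \<noteq> pi / 2"
  using assms by (cases p) (auto simp: pi_over_def numeral_eq_enat field_simps)

text \<open>By the half-angle formulas both sides are values of
  \<open>sqrt ((1 + x) / (1 - x))\<close>, where the quotient increases for \<open>x < 1\<close>.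
  The infinite values fit since the cosine lies in [-1, 1).\<close>

lemma parameter_bound_less_abs_cot_half_iff:
  assumes "cos \<alpha> \<noteq> 1"
  shows "parameter_bound x < ereal \<bar>cot (\<alpha> / 2)\<bar> \<longleftrightarrow> x < cos \<alpha>"
proof -
  have lt: "cos \<alpha> < 1" using assms cos_le_one[of \<alpha>] by linarith
  have ge: "cos \<alpha> \<ge> -1" by simp
  have c: "1 + cos \<alpha> = 2 * (cos (\<alpha> / 2))\<^sup>2" "1 - cos \<alpha> = 2 * (sin (\<alpha> / 2))\<^sup>2"
    using cos_double_cos[of "\<alpha> / 2"] cos_double_sin[of "\<alpha> / 2"] by simp_all
  have cot: "\<bar>cot (\<alpha> / 2)\<bar> = sqrt ((1 + cos \<alpha>) / (1 - cos \<alpha>))"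
    unfolding c by (simp add: cot_def power_divide[symmetric])
  have "(1 + x) / (1 - x) < (1 + cos \<alpha>) / (1 - cos \<alpha>) \<longleftrightarrow> x < cos \<alpha>" if "x < 1"
    using that lt by (simp add: divide_simps) (simp add: algebra_simps)
  moreover have "x < cos \<alpha>" if "x < - 1"
    using that ge by linarith
  ultimately show ?thesis
    using lt unfolding parameter_bound_def cot by auto
qed

lemma prod_UNIV_3: "(\<Prod>k\<in>UNIV. f (k :: 3)) = f 1 * f 2 * (f 3 :: 'a :: comm_monoid_mult)"
  unfolding UNIV_3 by (simp add: mult.assoc)

lemma cmod_herm_reflected_sq:
  "(cmod (herm (c 1) (complex_reflection (c 3) *v c 2)))\<^sup>2
    = 4 * (side_r c 1)\<^sup>2 * (side_r c 2)\<^sup>2 + (side_r c 3)\<^sup>2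
      - 4 * side_r c 1 * side_r c 2 * side_r c 3 * cos (angular_invariant c)"
proof -
  \<comment> \<open>Indices wrap around: \<open>k - 1\<close> at 1 and \<open>k + 1\<close> at 3
    produce these numerals.\<close>
  have mod_3: "(0 :: 3) = 3" "(4 :: 3) = 1" by simp_all
  let ?P = "\<Prod>k\<in>UNIV. herm (c (k - 1)) (c (k + 1))"
  let ?x = "herm (c 2) (c 1)" and ?y = "2 * herm (c 2) (c 3) * herm (c 3) (c 1)"
  have P: "?P = herm (c 3) (c 2) * herm (c 1) (c 3) * herm (c 2) (c 1)"
    by (simp add: prod_UNIV_3 mod_3)
  have r: "side_r c 1 = cmod (herm (c 3) (c 2))" "side_r c 2 = cmod (herm (c 1) (c 3))"
    "side_r c 3 = cmod (herm (c 2) (c 1))"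
    by (simp_all add: side_r_def mod_3)
  have swap: "cmod (herm u v) = cmod (herm v u)" for u v
    by (metis cnj_herm complex_mod_cnj)
  have cmod_diff: "(cmod (u - v))\<^sup>2 = (cmod u)\<^sup>2 + (cmod v)\<^sup>2 - 2 * Re (v * cnj u)" for u v
    unfolding cmod_power2 by (simp add: algebra_simps power2_eq_square)
  have "Re ?P = cmod ?P * cos (Arg ?P)"
    using Re_rcis[of "cmod ?P" "Arg ?P"] by (simp only: rcis_cmod_Arg)
  then have re: "Re ?P = side_r c 1 * side_r c 2 * side_r c 3 * cos (angular_invariant c)"
    by (simp add: angular_invariant_def P r norm_mult)
  have "herm (complex_reflection (c 3) *v c 2) (c 1) = ?y - ?x"
    by (simp add: complex_reflection_apply herm_left)
  then have "(cmod (herm (c 1) (complex_reflection (c 3) *v c 2)))\<^sup>2 = (cmod (?y - ?x))\<^sup>2"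
    by (simp only: swap[of "c 1"])
  also have "\<dots> = (cmod ?y)\<^sup>2 + (cmod ?x)\<^sup>2 - 2 * Re (?x * cnj ?y)"
    by (rule cmod_diff)
  \<comment> \<open>The cross term is the triple product whose argument is the angular
    invariant.\<close>
  also have "?x * cnj ?y = 2 * ?P"
    by (simp add: P cnj_herm algebra_simps)
  also have "Re (2 * ?P) = 2 * Re ?P" by simp
  also have "cmod ?y = 2 * side_r c 1 * side_r c 2"
    using swap by (simp add: r norm_mult)
  finally show ?thesis
    unfolding re by (simp add: r(3) power_mult_distrib)
qed

theorem proposition12:
  fixes p :: "3 \<Rightarrow> enat" and c :: "3 \<Rightarrow> complex^3" and t :: real
  assumes "\<forall>k. 3 \<le> p k"
    and "is_triangle p c"
    and "has_parameter c t"
    and "- t_inf (side_r c) < ereal t" and "ereal t < t_inf (side_r c)"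
  shows "regular_elliptic (word_A c) \<longleftrightarrow> ereal \<bar>t\<bar> > t_A (side_r c)"
proof -
  let ?r = "side_r c" and ?\<alpha> = "angular_invariant c"
  define b where "b = complex_reflection (c 3) *v c 2"
  have unit: "herm (c k) (c k) = 1" for k
    using assms(2) by (simp add: is_triangle_def)
  have r: "?r k > 0" for k
    unfolding side_r_def zero_less_norm_iff
    by (rule herm_nonzero_if_meet_at_angle[OF unit unit _ pi_over_neq_pi_half[of "p k"]])
      (use assms(1,2) in \<open>auto simp: is_triangle_def\<close>)
  then have r_pos: "0 < ?r 1 * ?r 2 * ?r 3" by simp
  have alpha: "?\<alpha> \<noteq> 0" and t: "t = cot (?\<alpha> / 2)"
    using assms(3) by (auto simp: has_parameter_def)
  have "- pi < ?\<alpha>" "?\<alpha> \<le> pi"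
    using Arg_bounded by (auto simp: angular_invariant_def)
  then have cos_less: "cos ?\<alpha> < 1"
    using alpha cos_monotone_0_pi[of 0 "\<bar>?\<alpha>\<bar>"] by simp
  have s: "(cmod (herm (c 1) b))\<^sup>2
      = 4 * (?r 1)\<^sup>2 * (?r 2)\<^sup>2 + (?r 3)\<^sup>2 - 4 * ?r 1 * ?r 2 * ?r 3 * cos ?\<alpha>"
    unfolding b_def by (rule cmod_herm_reflected_sq)
  \<comment> \<open>Completing the square isolates a term that is positive because
    \<open>cos ?\<alpha> < 1\<close>; at cosine 1 the sum could vanish.\<close>
  also have "\<dots> = (2 * ?r 1 * ?r 2 - ?r 3)\<^sup>2 + 4 * (?r 1 * ?r 2 * ?r 3) * (1 - cos ?\<alpha>)"
    by (simp add: power2_eq_square algebra_simps)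
  also have "\<dots> > 0"
    using r cos_less by (intro add_nonneg_pos mult_pos_pos) auto
  finally have nz: "herm (c 1) b \<noteq> 0" by auto
  have "herm b b = 1"
    using complex_reflection_in_U21[OF unit[of 3]] unit by (simp add: U21_def b_def)
  moreover have "word_A c = complex_reflection b ** complex_reflection (c 1)"
    unfolding word_A_def b_def complex_reflection_conjugate[OF unit] ..
  ultimately have "regular_elliptic (word_A c) \<longleftrightarrow> cmod (herm (c 1) b) < 1"
    using regular_elliptic_reflection_product_iff unit nz by simp
  also have "\<dots> \<longleftrightarrow> (cmod (herm (c 1) b))\<^sup>2 < 1"
    by (simp add: power_less_one_iff)
  also have "\<dots> \<longleftrightarrow> c_A ?r < cos ?\<alpha>"
    unfolding s c_A_def using r_pos r by (simp add: pos_divide_less_eq algebra_simps)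
  also have "\<dots> \<longleftrightarrow> t_A ?r < ereal \<bar>t\<bar>"
    unfolding t_A_def t using parameter_bound_less_abs_cot_half_iff[of ?\<alpha>] cos_less by simp
  finally show ?thesis .
qed

end
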